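(* Let $p\ge1$ and let $\Theta_1=\{(\xi^1,\dots,\xi^p)\in\mathbb{C}^p:\ |\xi^i|<1\text{ for all }i,\ \xi^i\ne\xi^j\text{ for }i\ne j\}$ be equipped with the Kähler metric $g_{i\bar j}=\frac{1}{1-\xi^i\bar\xi^j}$ ($i,j=1,\dots,p$), the Fisher information of the complex autoregressive model $\mathrm{AR}(p;\mathbb{C})$. Let $\Delta=2g^{i\bar j}\partial_i\partial_{\bar j}$ be its Laplacian and let $$\phi(\xi):=\prod_{i=1}^p\prod_{j=1}^p\bigl(1-\xi^i\bar\xi^j\bigr).$$ Then on $\Theta_1$ $$\Delta\phi=-p(p+1)\,\phi.$$
   Context: Einstein summation over $i,j\in\{1,\dots,p\}$ is used. For $\xi^i=x^i+\sqrt{-1}\,y^i$, $\partial_i=\frac12(\partial_{x^i}-\sqrt{-1}\,\partial_{y^i})$ and $\partial_{\bar i}=\frac12(\partial_{x^i}+\sqrt{-1}\,\partial_{y^i})$ are the Wirtinger derivatives. The Hermitian matrix $[g_{i\bar j}]$ is positive definite on $\Theta_1$, and $[g^{i\bar j}]$ denotes its inverse in the sense $g^{i\bar j}g_{k\bar j}=\delta^i_k$. *)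

theory Defs
  imports "HOL-Analysis.Analysis"
begin

text \<open>
  Points of \<open>\<complex>\<^sup>p\<close> are vectors \<open>\<xi> :: complex ^ 'p\<close> with \<open>p = CARD('p) \<ge> 1\<close>.
\<close>

definition partial_x :: "'p::finite \<Rightarrow> (complex ^ 'p \<Rightarrow> complex) \<Rightarrow> complex ^ 'p \<Rightarrow> complex" where
  "partial_x i f \<xi> = vector_derivative (\<lambda>t::real. f (\<xi> + t *\<^sub>R axis i 1)) (at 0)"

definition partial_y :: "'p::finite \<Rightarrow> (complex ^ 'p \<Rightarrow> complex) \<Rightarrow> complex ^ 'p \<Rightarrow> complex" where
  "partial_y i f \<xi> = vector_derivative (\<lambda>t::real. f (\<xi> + t *\<^sub>R axis i \<i>)) (at 0)"

definition wirtinger :: "'p::finite \<Rightarrow> (complex ^ 'p \<Rightarrow> complex) \<Rightarrow> complex ^ 'p \<Rightarrow> complex" where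
  "wirtinger i f \<xi> = (partial_x i f \<xi> - \<i> * partial_y i f \<xi>) / 2"

definition wirtinger_bar :: "'p::finite \<Rightarrow> (complex ^ 'p \<Rightarrow> complex) \<Rightarrow> complex ^ 'p \<Rightarrow> complex" where
  "wirtinger_bar i f \<xi> = (partial_x i f \<xi> + \<i> * partial_y i f \<xi>) / 2"

text \<open>
  A Hermitian metric is given by its matrix field, \<open>g \<xi> $ i $ j\<close> being the entry with
  holomorphic index \<open>i\<close> and antiholomorphic index \<open>j\<close>.  The raised-index matrix \<open>h\<close> is
  normalised by \<open>(\<Sum>j. h $ i $ j * g \<xi> $ k $ j) = (if i = k then 1 else 0)\<close>, that is
  \<open>h ** transpose (g \<xi>) = mat 1\<close>; hence the transpose below.
\<close>

definition inverse_metric ::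
    "(complex ^ 'p \<Rightarrow> complex ^ 'p ^ 'p) \<Rightarrow> complex ^ 'p \<Rightarrow> complex ^ 'p ^ 'p::finite" where
  "inverse_metric g \<xi> = matrix_inv (transpose (g \<xi>))"

definition kaehler_laplacian ::
    "(complex ^ 'p \<Rightarrow> complex ^ 'p ^ 'p) \<Rightarrow> (complex ^ 'p::finite \<Rightarrow> complex) \<Rightarrow> complex ^ 'p \<Rightarrow> complex" where
  "kaehler_laplacian g f \<xi> =
     2 * (\<Sum>i\<in>UNIV. \<Sum>j\<in>UNIV. inverse_metric g \<xi> $ i $ j * wirtinger i (wirtinger_bar j f) \<xi>)"

definition Theta1 :: "(complex ^ 'p::finite) set" where
  "Theta1 = {\<xi>. (\<forall>i. cmod (\<xi> $ i) < 1) \<and> (\<forall>i j. i \<noteq> j \<longrightarrow> \<xi> $ i \<noteq> \<xi> $ j)}"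

definition ar_metric :: "complex ^ 'p::finite \<Rightarrow> complex ^ 'p ^ 'p" where
  "ar_metric \<xi> = (\<chi> i j. 1 / (1 - \<xi> $ i * cnj (\<xi> $ j)))"

definition ar_phi :: "complex ^ 'p::finite \<Rightarrow> complex" where
  "ar_phi \<xi> = (\<Prod>i\<in>UNIV. \<Prod>j\<in>UNIV. 1 - \<xi> $ i * cnj (\<xi> $ j))"

end

theory Submission
  imports Defs "HOL-Computational_Algebra.Polynomial"
begin

text \<open>
  Write \<open>z\<^sub>i = \<xi>\<^sup>i\<close>, \<open>w\<^sub>j\<close> for the conjugate of \<open>\<xi>\<^sup>j\<close>, \<open>g\<^sub>i\<^sub>j = 1 / (1 - z\<^sub>i w\<^sub>j)\<close>, \<open>h\<close> for the
  inverse metric and \<open>S = \<Sum>\<^sub>i\<^sub>j z\<^sub>i w\<^sub>j g\<^sub>i\<^sub>j\<close>. Logarithmic differentiation of the product \<open>\<phi>\<close>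
  gives \<open>\<Delta>\<phi> = 2 \<phi> \<Sum>\<^sub>i\<^sub>j h\<^sub>i\<^sub>j (A\<^sub>i B\<^sub>j - g\<^sub>i\<^sub>j\<^sup>2)\<close> with \<open>A\<^sub>i = - \<Sum>\<^sub>b w\<^sub>b g\<^sub>i\<^sub>b\<close> and
  \<open>B\<^sub>j = - \<Sum>\<^sub>a z\<^sub>a g\<^sub>a\<^sub>j\<close>. As \<open>A\<^sub>i\<close> is a combination of columns of \<open>g\<close>, the first part contracts
  to \<open>S\<close>. For the second, \<open>F\<^sub>i(x) = \<Sum>\<^sub>j h\<^sub>i\<^sub>j / (1 - x w\<^sub>j)\<close> is a rational function with
  \<open>F\<^sub>i(z\<^sub>k) = \<delta>\<^sub>i\<^sub>k\<close>, hence known in factored form, and \<open>\<Sum>\<^sub>j h\<^sub>i\<^sub>j g\<^sub>i\<^sub>j\<^sup>2 = 1 + z\<^sub>i F\<^sub>i'(z\<^sub>i)\<close>.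
  Summing over \<open>i\<close> yields \<open>p + p (p - 1) / 2 + S\<close>, where the middle term comes from pairing
  \<open>z\<^sub>i / (z\<^sub>i - z\<^sub>k)\<close> with \<open>z\<^sub>k / (z\<^sub>k - z\<^sub>i)\<close>.
\<close>

section \<open>Derivatives of products along a real parameter\<close>

text \<open>Writing each derivative as \<open>f i t * l i\<close> makes logarithmic derivatives add
  without any division. The conclusion has the shape of the premise, so the rule can be nested for
  double products.\<close>

lemma has_vector_derivative_prod_log:
  fixes f :: "'a \<Rightarrow> real \<Rightarrow> complex"
  assumes "finite I" "\<And>i. i \<in> I \<Longrightarrow> (f i has_vector_derivative f i t * l i) (at t)"
  shows "((\<lambda>s. \<Prod>i\<in>I. f i s) has_vector_derivative (\<Prod>i\<in>I. f i t) * (\<Sum>i\<in>I. l i)) (at t)"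
  using assms
proof (induction I rule: finite_induct)
  case empty
  then show ?case by simp
next
  case (insert i I)
  have "((\<lambda>s. f i s * (\<Prod>i\<in>I. f i s)) has_vector_derivative
      f i t * ((\<Prod>i\<in>I. f i t) * (\<Sum>i\<in>I. l i)) + f i t * l i * (\<Prod>i\<in>I. f i t)) (at t)"
    using insert by (intro has_vector_derivative_mult) auto
  then show ?case
    using insert.hyps by (simp add: algebra_simps)
qed

lemma has_vector_derivative_transform_at:
  assumes "(f has_vector_derivative d) (at x)" "\<forall>\<^sub>F y in at x. f y = g y" "f x = g x"
  shows "(g has_vector_derivative d) (at x)"
  using assms has_derivative_transform_eventually
  unfolding has_vector_derivative_def by blast


subsection \<open>The matrix with entries \<open>1 / (1 - z\<^sub>i w\<^sub>j)\<close>\<close>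

text \<open>The conjugates become an independent family \<open>w\<close>: the contraction identity
  is purely algebraic and needs no relation between \<open>z\<close> and \<open>w\<close> beyond
  \<open>neq1\<close>.\<close>

locale cauchy_nodes =
  fixes z w :: "'p::finite \<Rightarrow> complex"
  assumes inj_z: "inj z" and inj_w: "inj w" and neq1: "\<And>i j. z i * w j \<noteq> 1"
begin

text \<open>The numerator of \<open>\<Sum>\<^sub>j c\<^sub>j / (1 - x w\<^sub>j)\<close>.\<close>

definition numer :: "('p \<Rightarrow> complex) \<Rightarrow> complex poly" where
  "numer c = (\<Sum>j\<in>UNIV. smult (c j) (\<Prod>l\<in>UNIV-{j}. [:1, - w l:]))"

lemma degree_numer: "degree (numer c) < CARD('p)"
proof -
  have "degree (smult (c j) (\<Prod>l\<in>UNIV-{j}. [:1, - w l:])) \<le> CARD('p) - 1" for j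
  proof -
    have "degree (\<Prod>l\<in>UNIV-{j}. [:1, - w l:]) \<le> (\<Sum>l\<in>UNIV-{j}. degree [:1, - w l:])"
      using degree_prod_sum_le[of "UNIV-{j}" "\<lambda>l. [:1, - w l:]"] by (simp add: o_def)
    also have "\<dots> \<le> (\<Sum>l\<in>UNIV-{j}. 1)"
      by (intro sum_mono) simp
    finally have "degree (\<Prod>l\<in>UNIV-{j}. [:1, - w l:]) \<le> CARD('p) - 1"
      by (simp add: card_Diff_singleton)
    then show ?thesis
      using degree_smult_le order_trans by blast
  qed
  then have "degree (numer c) \<le> CARD('p) - 1"
    unfolding numer_def by (intro degree_sum_le) auto
  then show ?thesis
    by (meson diff_less le_less_trans zero_less_card_finite zero_less_one)
qed

lemma poly_numer:
  assumes "\<And>l. x * w l \<noteq> 1"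
  shows "poly (numer c) x = (\<Sum>j\<in>UNIV. c j / (1 - x * w j)) * (\<Prod>l\<in>UNIV. 1 - x * w l)"
proof -
  have "(\<Prod>l\<in>UNIV-{j}. 1 - x * w l) = (\<Prod>l\<in>UNIV. 1 - x * w l) / (1 - x * w j)" for j
    using assms[of j] by (subst (2) prod.remove[of _ j]) auto
  then show ?thesis
    by (simp add: numer_def poly_sum poly_prod sum_distrib_right)
qed

text \<open>At \<open>1 / w m\<close> every summand except the one of index \<open>m\<close>
  vanishes, which isolates \<open>c m\<close>. By injectivity at most one \<open>w m\<close> is 0;
  its coefficient is what remains at \<open>x = 0\<close>, where all factors are 1.\<close>

lemma numer_eq_0_imp:
  assumes "numer c = 0"
  shows "c m = 0"
proof -
  have eval: "c m * (\<Prod>l\<in>UNIV-{m}. 1 - x * w l)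
      = - (\<Sum>j\<in>UNIV-{m}. c j * (\<Prod>l\<in>UNIV-{j}. 1 - x * w l))" for x m
  proof -
    have "0 = (\<Sum>j\<in>UNIV. c j * (\<Prod>l\<in>UNIV-{j}. 1 - x * w l))"
      using arg_cong[OF assms, of "\<lambda>p. poly p x"] by (simp add: numer_def poly_sum poly_prod)
    also have "\<dots> = c m * (\<Prod>l\<in>UNIV-{m}. 1 - x * w l)
        + (\<Sum>j\<in>UNIV-{m}. c j * (\<Prod>l\<in>UNIV-{j}. 1 - x * w l))"
      by (rule sum.remove) auto
    finally show ?thesis by (simp add: eq_neg_iff_add_eq_0)
  qed
  have nonzero: "c m = 0" if "w m \<noteq> 0" for m
  proof -
    have "(\<Prod>l\<in>UNIV-{j}. 1 - (1 / w m) * w l) = 0" if "j \<noteq> m" for j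
      using that \<open>w m \<noteq> 0\<close> by (intro prod_zero) (auto intro!: bexI[of _ m])
    then have "(\<Sum>j\<in>UNIV-{m}. c j * (\<Prod>l\<in>UNIV-{j}. 1 - (1 / w m) * w l)) = 0"
      by (intro sum.neutral ballI) (simp only: Diff_iff singleton_iff not_False_eq_True mult_zero_right)
    then have "c m * (\<Prod>l\<in>UNIV-{m}. 1 - (1 / w m) * w l) = 0"
      by (subst eval) (simp only: minus_zero)
    moreover have "(\<Prod>l\<in>UNIV-{m}. 1 - (1 / w m) * w l) \<noteq> 0"
      using that inj_w by (auto simp: inj_def)
    ultimately show ?thesis by (simp only: mult_eq_0_iff) blast
  qed
  show ?thesis
  proof (cases "w m = 0")
    case True
    then have "c j = 0" if "j \<noteq> m" for j
      using that inj_w nonzero by (metis injD)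
    then show ?thesis using eval[of m 0] by simp
  qed (rule nonzero)
qed

text \<open>Nonsingularity without the Cauchy determinant: \<open>numer c\<close> has degree below p
  and vanishes at the p distinct nodes \<open>z k\<close>, so it is the zero polynomial.\<close>

lemma cauchy_kernel_trivial:
  assumes "\<And>k. (\<Sum>j\<in>UNIV. c j / (1 - z k * w j)) = 0"
  shows "c m = 0"
proof (rule numer_eq_0_imp, rule poly_eqI_degree[of "range z"])
  show "poly (numer c) x = poly 0 x" if "x \<in> range z" for x
    using that assms neq1 by (auto simp: poly_numer)
  show "degree (numer c) < card (range z)" "degree 0 < card (range z)"
    using degree_numer[of c] inj_z by (auto simp: card_image)
qed

text \<open>\<open>numer c\<close> vanishes at every \<open>z k\<close> with
  \<open>k \<noteq> i\<close>, so it is a multiple of the product of the \<open>x - z k\<close>.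
  Comparing logarithmic derivatives at \<open>z i\<close>, where the sum equals 1, gives its
  derivative there.\<close>

lemma cauchy_dual_sum_squares:
  assumes dual: "\<And>k. (\<Sum>j\<in>UNIV. c j / (1 - z k * w j)) = (if k = i then 1 else 0)"
  shows "(\<Sum>j\<in>UNIV. c j / (1 - z i * w j)\<^sup>2)
    = 1 + (\<Sum>k\<in>UNIV-{i}. z i / (z i - z k)) + (\<Sum>j\<in>UNIV. z i * w j / (1 - z i * w j))"
proof -
  define P where "P = (\<Prod>k\<in>UNIV-{i}. [:- z k, 1:])"
  \<comment> \<open>Chosen to match \<open>numer c\<close> at the remaining node \<open>z i\<close>;
    its value cancels in the logarithmic derivative.\<close>
  define a where "a = poly (numer c) (z i) / poly P (z i)"
  have poly_P: "poly P x = (\<Prod>k\<in>UNIV-{i}. x - z k)" for x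
    by (simp add: P_def poly_prod)
  have P_nz: "poly P (z i) \<noteq> 0"
    using inj_z by (auto simp: poly_P inj_def)
  have numer_eq: "numer c = smult a P"
  proof (rule poly_eqI_degree[of "range z"])
    fix x assume "x \<in> range z"
    then obtain k where k: "x = z k" by auto
    show "poly (numer c) x = poly (smult a P) x"
    proof (cases "k = i")
      case True
      then show ?thesis using P_nz by (simp add: a_def k)
    next
      case False
      then have "poly P x = 0" by (auto simp: poly_P k)
      then show ?thesis using False neq1 by (simp add: k poly_numer dual)
    qed
  next
    show "degree (numer c) < card (range z)"
      using degree_numer[of c] inj_z by (simp add: card_image)
    have "degree P \<le> (\<Sum>k\<in>UNIV-{i}. 1)"
      unfolding P_def
      using degree_prod_sum_le[of "UNIV-{i}" "\<lambda>l. [:- z l, 1:]"] by (simp add: o_def)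
    then have "degree (smult a P) \<le> CARD('p) - 1"
      by (simp add: card_Diff_singleton)
    then have "degree (smult a P) < CARD('p)"
      by (meson diff_less le_less_trans zero_less_card_finite zero_less_one)
    then show "degree (smult a P) < card (range z)"
      using inj_z by (simp only: card_image)
  qed
  define x where "x = (\<lambda>t::real. z i + of_real t)"
  have x0: "x 0 = z i" by (simp add: x_def)
  have dx: "(x has_vector_derivative 1) (at 0)"
    using has_vector_derivative_add[OF has_vector_derivative_const[of "z i"]
        has_vector_derivative_of_real[OF DERIV_ident[of "at 0"]]]
    by (simp add: x_def)
  \<comment> \<open>\<open>poly_numer\<close> holds only off the poles, so the two expressions for
    the numerator are compared near \<open>t = 0\<close>.\<close>
  have ev: "\<forall>\<^sub>F t in at 0. \<forall>l. x t * w l \<noteq> 1"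
  proof (intro eventually_all_finite)
    fix l
    have "((\<lambda>t. x t * w l) \<longlongrightarrow> (z i + of_real 0) * w l) (at 0)"
      unfolding x_def by (intro tendsto_intros)
    then show "\<forall>\<^sub>F t in at 0. x t * w l \<noteq> 1"
      using neq1 by (intro tendsto_imp_eventually_ne) auto
  qed
  let ?F = "\<lambda>t. \<Sum>j\<in>UNIV. c j / (1 - x t * w j)"
  let ?D = "\<lambda>t. \<Prod>l\<in>UNIV. 1 - x t * w l"
  have F1: "(?F has_vector_derivative (\<Sum>j\<in>UNIV. c j * w j / (1 - z i * w j)\<^sup>2)) (at 0)"
  proof (intro has_vector_derivative_sum)
    fix j
    have "((\<lambda>y. c j / (1 - y * w j)) has_field_derivative c j * w j / (1 - z i * w j)\<^sup>2) (at (x 0))"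
      using neq1[of i j]
      by (auto intro!: derivative_eq_intros simp: x0 power2_eq_square)
    from field_vector_diff_chain_at[OF dx this]
    show "((\<lambda>t. c j / (1 - x t * w j)) has_vector_derivative c j * w j / (1 - z i * w j)\<^sup>2) (at 0)"
      by (simp add: o_def)
  qed
  have dP: "((\<lambda>t. poly P (x t)) has_vector_derivative
      poly P (x 0) * (\<Sum>k\<in>UNIV-{i}. 1 / (z i - z k))) (at 0)"
    unfolding poly_P
  proof (intro has_vector_derivative_prod_log)
    fix k assume "k \<in> UNIV-{i}"
    then have "z i \<noteq> z k" using inj_z by (auto simp: inj_def)
    then show "((\<lambda>t. x t - z k) has_vector_derivative (x 0 - z k) * (1 / (z i - z k))) (at 0)"
      using has_vector_derivative_diff[OF dx has_vector_derivative_const[of "z k"]] by (simp add: x0)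
  qed auto
  have dD: "((\<lambda>t. ?D t) has_vector_derivative
      ?D 0 * (\<Sum>l\<in>UNIV. - w l / (1 - z i * w l))) (at 0)"
  proof (intro has_vector_derivative_prod_log)
    fix l
    have "((\<lambda>t. 1 - x t * w l) has_vector_derivative (0 - 1 * w l)) (at 0)"
      by (intro has_vector_derivative_diff has_vector_derivative_const
          has_vector_derivative_mult_left dx)
    then show "((\<lambda>t. 1 - x t * w l) has_vector_derivative (1 - x 0 * w l) * (- w l / (1 - z i * w l))) (at 0)"
      using neq1[of i l] by (simp add: x0)
  qed auto
  have FD: "((\<lambda>t. ?F t * ?D t) has_vector_derivative
      ?F 0 * (?D 0 * (\<Sum>l\<in>UNIV. - w l / (1 - z i * w l)))
      + (\<Sum>j\<in>UNIV. c j * w j / (1 - z i * w j)\<^sup>2) * ?D 0) (at 0)"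
    by (intro has_vector_derivative_mult F1 dD)
  have "((\<lambda>t. a * poly P (x t)) has_vector_derivative
      a * (poly P (x 0) * (\<Sum>k\<in>UNIV-{i}. 1 / (z i - z k)))) (at 0)"
    by (intro has_vector_derivative_mult_right dP)
  then have "((\<lambda>t. ?F t * ?D t) has_vector_derivative
      a * (poly P (x 0) * (\<Sum>k\<in>UNIV-{i}. 1 / (z i - z k)))) (at 0)"
  proof (rule has_vector_derivative_transform_at)
    have *: "a * poly P (x t) = ?F t * ?D t" if "\<forall>l. x t * w l \<noteq> 1" for t
      using poly_numer[of "x t" c] that by (simp add: numer_eq)
    show "\<forall>\<^sub>F t in at 0. a * poly P (x t) = ?F t * ?D t"
      using ev by eventually_elim (rule *)
    show "a * poly P (x 0) = ?F 0 * ?D 0"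
      by (rule *) (auto simp: x0 neq1)
  qed
  from vector_derivative_unique_at[OF FD this]
  have "?F 0 * (?D 0 * (\<Sum>l\<in>UNIV. - w l / (1 - z i * w l)))
      + (\<Sum>j\<in>UNIV. c j * w j / (1 - z i * w j)\<^sup>2) * ?D 0
      = a * poly P (x 0) * (\<Sum>k\<in>UNIV-{i}. 1 / (z i - z k))"
    by (simp only: mult.assoc)
  moreover have "a * poly P (x 0) = ?D 0"
  proof -
    have "a * poly P (x 0) = poly (numer c) (z i)"
      by (simp add: numer_eq x0)
    then show ?thesis using neq1 by (simp add: poly_numer dual x0)
  qed
  moreover have "?F 0 = 1"
    by (simp add: x0 dual)
  moreover have D_nz: "?D 0 \<noteq> 0"
    using neq1 by (auto simp: x0)
  ultimately have "?D 0 * (\<Sum>j\<in>UNIV. c j * w j / (1 - z i * w j)\<^sup>2)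
      = ?D 0 * ((\<Sum>k\<in>UNIV-{i}. 1 / (z i - z k)) + (\<Sum>l\<in>UNIV. w l / (1 - z i * w l)))"
    by (simp add: sum_negf algebra_simps)
  then have deriv: "(\<Sum>j\<in>UNIV. c j * w j / (1 - z i * w j)\<^sup>2)
      = (\<Sum>k\<in>UNIV-{i}. 1 / (z i - z k)) + (\<Sum>l\<in>UNIV. w l / (1 - z i * w l))"
    using D_nz by (simp only: mult_cancel_left) blast
  \<comment> \<open>With \<open>u = 1 - z i * w j\<close>, divide \<open>1 = u + z i * w j\<close>
    by the square of \<open>u\<close>.\<close>
  have "c j / (1 - z i * w j)\<^sup>2
      = c j / (1 - z i * w j) + z i * (c j * w j / (1 - z i * w j)\<^sup>2)" for j
    using neq1[of i j] by (simp add: divide_simps) (simp add: algebra_simps power2_eq_square)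
  then have "(\<Sum>j\<in>UNIV. c j / (1 - z i * w j)\<^sup>2)
      = 1 + z i * (\<Sum>j\<in>UNIV. c j * w j / (1 - z i * w j)\<^sup>2)"
    by (simp add: sum.distrib sum_distrib_left dual)
  then show ?thesis
    unfolding deriv by (simp add: sum_distrib_left distrib_left)
qed

lemma sum_quotient_differences:
  "2 * (\<Sum>i\<in>UNIV. \<Sum>k\<in>UNIV-{i}. z i / (z i - z k)) = of_nat CARD('p) * (of_nat CARD('p) - 1)"
proof -
  \<comment> \<open>Extension by zero makes the inner range independent of \<open>i\<close>, so that
    \<open>sum.swap\<close> applies.\<close>
  have expand: "(\<Sum>k\<in>UNIV-{i}. f k) = (\<Sum>k\<in>UNIV. if k = i then 0 else f k)"
    for f :: "'p \<Rightarrow> complex" and i :: 'p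
    by (rule sum.mono_neutral_cong_left) auto
  let ?T = "\<Sum>i\<in>UNIV. \<Sum>k\<in>UNIV-{i}. z i / (z i - z k)"
  have swap: "?T = (\<Sum>i\<in>UNIV. \<Sum>k\<in>UNIV-{i}. z k / (z k - z i))"
    unfolding expand by (subst sum.swap) (intro sum.cong refl, auto)
  have "2 * ?T = (\<Sum>i\<in>UNIV. \<Sum>k\<in>UNIV-{i}. z i / (z i - z k) + z k / (z k - z i))"
    unfolding sum.distrib by (subst swap[symmetric]) simp
  also have "\<dots> = (\<Sum>i\<in>(UNIV::'p set). \<Sum>k\<in>UNIV-{i}. 1)"
  proof (intro sum.cong refl)
    fix i k :: 'p assume "k \<in> UNIV - {i}"
    then have "z i - z k \<noteq> 0" "z k - z i = - (z i - z k)" using inj_z by (auto simp: inj_def)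
    then show "z i / (z i - z k) + z k / (z k - z i) = 1"
      by (metis divide_minus_right diff_divide_distrib add_uminus_conv_diff divide_self)
  qed
  also have "\<dots> = of_nat CARD('p) * of_nat (CARD('p) - 1)"
    by (simp add: card_Diff_singleton)
  finally show ?thesis
    by (simp add: of_nat_diff Suc_leI)
qed

text \<open>\<open>right\<close> collapses the product term to S, and \<open>left\<close> feeds
  \<open>cauchy_dual_sum_squares\<close> for the squares. S cancels, leaving -2p - p(p - 1).\<close>

lemma cauchy_contraction:
  assumes left: "\<And>i k. (\<Sum>j\<in>UNIV. h i j / (1 - z k * w j)) = (if k = i then 1 else 0)"
    and right: "\<And>j k. (\<Sum>i\<in>UNIV. h i j / (1 - z i * w k)) = (if k = j then 1 else 0)"
  shows "2 * (\<Sum>i\<in>UNIV. \<Sum>j\<in>UNIV. h i j *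
      ((\<Sum>b\<in>UNIV. w b / (1 - z i * w b)) * (\<Sum>a\<in>UNIV. z a / (1 - z a * w j))
        - 1 / (1 - z i * w j)\<^sup>2))
    = - (of_nat CARD('p) * (of_nat CARD('p) + 1))"
proof -
  let ?B = "\<lambda>j. \<Sum>a\<in>UNIV. z a / (1 - z a * w j)"
  let ?S = "\<Sum>i\<in>UNIV. \<Sum>j\<in>UNIV. z i * w j / (1 - z i * w j)"
  have "(\<Sum>i\<in>UNIV. \<Sum>j\<in>UNIV. h i j * ((\<Sum>b\<in>UNIV. w b / (1 - z i * w b)) * ?B j))
      = (\<Sum>i\<in>UNIV. \<Sum>j\<in>UNIV. \<Sum>b\<in>UNIV. w b * ?B j * (h i j / (1 - z i * w b)))"
  proof (intro sum.cong refl)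
    fix i j
    show "h i j * ((\<Sum>b\<in>UNIV. w b / (1 - z i * w b)) * ?B j)
        = (\<Sum>b\<in>UNIV. w b * ?B j * (h i j / (1 - z i * w b)))"
      unfolding sum_distrib_right[of _ _ "?B j"] sum_distrib_left[of "h i j"]
      by (simp only: mult_ac times_divide_eq_left times_divide_eq_right)
  qed
  \<comment> \<open>The sum over \<open>i\<close> is moved innermost, where \<open>right\<close>
    evaluates it.\<close>
  also have "\<dots> = (\<Sum>j\<in>UNIV. \<Sum>i\<in>UNIV. \<Sum>b\<in>UNIV. w b * ?B j * (h i j / (1 - z i * w b)))"
    by (rule sum.swap)
  also have "\<dots> = (\<Sum>j\<in>UNIV. \<Sum>b\<in>UNIV. \<Sum>i\<in>UNIV. w b * ?B j * (h i j / (1 - z i * w b)))"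
    by (intro sum.cong refl sum.swap)
  also have "\<dots> = (\<Sum>j\<in>UNIV. \<Sum>b\<in>UNIV. w b * ?B j * (if b = j then 1 else 0))"
    unfolding sum_distrib_left[symmetric] right ..
  also have "\<dots> = (\<Sum>j\<in>UNIV. w j * ?B j)"
    by (intro sum.cong refl) (simp add: if_distrib cong: if_cong)
  also have "\<dots> = (\<Sum>j\<in>UNIV. \<Sum>i\<in>UNIV. z i * w j / (1 - z i * w j))"
    by (simp add: sum_distrib_left mult_ac)
  also have "\<dots> = ?S"
    by (rule sum.swap)
  finally have first: "(\<Sum>i\<in>UNIV. \<Sum>j\<in>UNIV.
      h i j * ((\<Sum>b\<in>UNIV. w b / (1 - z i * w b)) * ?B j)) = ?S" .
  have second: "(\<Sum>i\<in>UNIV. \<Sum>j\<in>UNIV. h i j / (1 - z i * w j)\<^sup>2)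
      = of_nat CARD('p) + (\<Sum>i\<in>UNIV. \<Sum>k\<in>UNIV-{i}. z i / (z i - z k)) + ?S"
    by (simp add: cauchy_dual_sum_squares[OF left] sum.distrib)
  show ?thesis
    unfolding right_diff_distrib sum_subtractf first times_divide_eq_right mult_1_right second
    using sum_quotient_differences by (simp add: algebra_simps)
qed

end


subsection \<open>Wirtinger derivatives\<close>

text \<open>One real derivative in an arbitrary direction \<open>v\<close> yields both Wirtinger
  derivatives, as the coefficients of \<open>v\<close> and \<open>cnj v\<close>; the directions 1
  and \<open>\<i>\<close> determine them.\<close>

lemma wirtinger_eqI:
  assumes "\<And>v. ((\<lambda>t. f (\<xi> + t *\<^sub>R axis i v)) has_vector_derivative a * v + b * cnj v) (at 0)"
  shows "wirtinger i f \<xi> = a" "wirtinger_bar i f \<xi> = b"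
proof -
  have "partial_x i f \<xi> = a + b" "partial_y i f \<xi> = a * \<i> - b * \<i>"
    using vector_derivative_at[OF assms[of 1]] vector_derivative_at[OF assms[of \<i>]]
    by (simp_all add: partial_x_def partial_y_def)
  then show "wirtinger i f \<xi> = a" "wirtinger_bar i f \<xi> = b"
    by (simp_all add: wirtinger_def wirtinger_bar_def right_diff_distrib mult.left_commute[of \<i>])
qed

lemma has_vector_derivative_coord:
  "((\<lambda>t. (\<xi> + t *\<^sub>R axis i v) $ a) has_vector_derivative (if a = i then v else 0)) (at 0)"
  for \<xi> :: "complex ^ 'p::finite"
proof -
  have "((\<lambda>t. \<xi> $ a + t *\<^sub>R (axis i v $ a)) has_vector_derivative
      0 + (0 *\<^sub>R 0 + 1 *\<^sub>R (axis i v $ a))) (at 0)"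
    by (intro has_vector_derivative_add has_vector_derivative_const has_vector_derivative_scaleR
        DERIV_ident)
  then show ?thesis by (simp add: axis_def)
qed

lemma has_vector_derivative_cnj_coord:
  "((\<lambda>t. cnj ((\<xi> + t *\<^sub>R axis i v) $ a)) has_vector_derivative (if a = i then cnj v else 0)) (at 0)"
  for \<xi> :: "complex ^ 'p::finite"
  using has_vector_derivative_cnj[OF has_vector_derivative_coord[of \<xi> i v a]] by (simp split: if_splits)

lemma has_vector_derivative_factor:
  fixes \<xi> :: "complex ^ 'p::finite"
  defines "x \<equiv> \<lambda>t v i. \<xi> + t *\<^sub>R axis i v"
  shows "((\<lambda>t. 1 - x t v i $ a * cnj (x t v i $ b)) has_vector_derivative
    - (\<xi> $ a * (if b = i then cnj v else 0) + (if a = i then v else 0) * cnj (\<xi> $ b))) (at 0)"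
proof -
  have "((\<lambda>t. 1 - x t v i $ a * cnj (x t v i $ b)) has_vector_derivative
    0 - (x 0 v i $ a * (if b = i then cnj v else 0) + (if a = i then v else 0) * cnj (x 0 v i $ b))) (at 0)"
    unfolding x_def
    by (intro has_vector_derivative_diff has_vector_derivative_const has_vector_derivative_mult
       has_vector_derivative_coord has_vector_derivative_cnj_coord)
  then show ?thesis by (simp add: x_def)
qed

text \<open>The Wirtinger derivative of log phi in coordinate \<open>i\<close>, summed over the
  factors of row \<open>i\<close>; \<open>phi_dlog_bar\<close> is its antiholomorphic counterpart,
  over a column.\<close>

definition phi_dlog :: "'p \<Rightarrow> complex ^ 'p::finite \<Rightarrow> complex" where
  "phi_dlog i \<xi> = - (\<Sum>b\<in>UNIV. cnj (\<xi> $ b) / (1 - \<xi> $ i * cnj (\<xi> $ b)))"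

definition phi_dlog_bar :: "'p \<Rightarrow> complex ^ 'p::finite \<Rightarrow> complex" where
  "phi_dlog_bar j \<xi> = - (\<Sum>a\<in>UNIV. \<xi> $ a / (1 - \<xi> $ a * cnj (\<xi> $ j)))"

lemma has_vector_derivative_ar_phi:
  fixes \<xi> :: "complex ^ 'p::finite"
  assumes neq1: "\<And>a b. \<xi> $ a * cnj (\<xi> $ b) \<noteq> 1"
  shows "((\<lambda>t. ar_phi (\<xi> + t *\<^sub>R axis i v)) has_vector_derivative
    ar_phi \<xi> * (phi_dlog i \<xi> * v + phi_dlog_bar i \<xi> * cnj v)) (at 0)"
proof -
  define l where "l = (\<lambda>a b. - (\<xi> $ a * (if b = i then cnj v else 0) + (if a = i then v else 0) * cnj (\<xi> $ b))
      / (1 - \<xi> $ a * cnj (\<xi> $ b)))"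
  have "((\<lambda>t. ar_phi (\<xi> + t *\<^sub>R axis i v)) has_vector_derivative
     (\<Prod>a\<in>UNIV. \<Prod>b\<in>UNIV. 1 - (\<xi> + 0 *\<^sub>R axis i v) $ a * cnj ((\<xi> + 0 *\<^sub>R axis i v) $ b))
       * (\<Sum>a\<in>UNIV. \<Sum>b\<in>UNIV. l a b)) (at 0)"
    unfolding ar_phi_def
  proof (intro has_vector_derivative_prod_log finite)
    fix a b
    show "((\<lambda>t. 1 - (\<xi> + t *\<^sub>R axis i v) $ a * cnj ((\<xi> + t *\<^sub>R axis i v) $ b)) has_vector_derivative
      (1 - (\<xi> + 0 *\<^sub>R axis i v) $ a * cnj ((\<xi> + 0 *\<^sub>R axis i v) $ b)) * l a b) (at 0)"
      using has_vector_derivative_factor[of \<xi> i v a b] neq1[of a b] by (simp add: l_def)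
  qed
  moreover have "(\<Sum>a\<in>UNIV. \<Sum>b\<in>UNIV. l a b) = phi_dlog i \<xi> * v + phi_dlog_bar i \<xi> * cnj v"
  proof -
    \<comment> \<open>Row \<open>i\<close> carries the \<open>v\<close> part and column
      \<open>i\<close> the \<open>cnj v\<close> part; the diagonal factor contributes to
      both.\<close>
    have l: "l a b = (if b = i then - (\<xi> $ a * cnj v / (1 - \<xi> $ a * cnj (\<xi> $ b))) else 0)
        + (if a = i then - (v * cnj (\<xi> $ b) / (1 - \<xi> $ a * cnj (\<xi> $ b))) else 0)" for a b
      by (simp add: l_def add_divide_distrib diff_divide_distrib)
    have if_sum: "(\<Sum>b\<in>UNIV. if a = i then f b else 0) = (if a = i then \<Sum>b\<in>UNIV. f b else 0)"
      for a and f :: "'p \<Rightarrow> complex" by simp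
    show ?thesis
      unfolding l sum.distrib if_sum phi_dlog_def phi_dlog_bar_def
      by (simp add: sum_negf sum_distrib_left sum_distrib_right mult_ac)
  qed
  ultimately show ?thesis by (simp add: ar_phi_def)
qed

text \<open>Product rule for \<open>ar_phi * phi_dlog_bar j\<close>. In
  \<open>phi_dlog_bar j\<close> only the summand \<open>a = i\<close> varies holomorphically, and z
  / (1 - z w) has z-derivative \<open>1 / (1 - z * w)\<^sup>2\<close>.\<close>

lemma wirtinger_wirtinger_bar_ar_phi:
  fixes \<xi> :: "complex ^ 'p::finite"
  assumes neq1: "\<And>a b. \<xi> $ a * cnj (\<xi> $ b) \<noteq> 1"
  shows "wirtinger i (wirtinger_bar j ar_phi) \<xi>
    = ar_phi \<xi> * (phi_dlog i \<xi> * phi_dlog_bar j \<xi> - 1 / (1 - \<xi> $ i * cnj (\<xi> $ j))\<^sup>2)"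
proof (rule wirtinger_eqI(1))
  fix v :: complex
  define x where "x = (\<lambda>t. \<xi> + t *\<^sub>R axis i v)"
  \<comment> \<open>Up to sign, the antiholomorphic derivative of \<open>phi_dlog_bar j\<close>:
    \<open>wirtinger_eqI\<close> asks for the full real derivative, including its
    \<open>cnj v\<close> part.\<close>
  define S where "S = (if i = j then \<Sum>a\<in>UNIV. (\<xi> $ a)\<^sup>2 / (1 - \<xi> $ a * cnj (\<xi> $ j))\<^sup>2 else 0)"
  have x0: "x 0 = \<xi>" by (simp add: x_def)
  have bar: "wirtinger_bar j ar_phi \<eta> = ar_phi \<eta> * phi_dlog_bar j \<eta>"
    if "\<And>a b. \<eta> $ a * cnj (\<eta> $ b) \<noteq> 1" for \<eta> :: "complex ^ 'p"
    using that has_vector_derivative_ar_phi[of \<eta> j]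
    by (intro wirtinger_eqI(2)[where a = "ar_phi \<eta> * phi_dlog j \<eta>"]) (simp add: algebra_simps)
  have dlog: "((\<lambda>t. phi_dlog_bar j (x t)) has_vector_derivative
      - v / (1 - \<xi> $ i * cnj (\<xi> $ j))\<^sup>2 - S * cnj v) (at 0)"
  proof -
    let ?d = "\<lambda>a. (if a = i then v else 0) / (1 - \<xi> $ a * cnj (\<xi> $ j))\<^sup>2
        + (if i = j then (\<xi> $ a)\<^sup>2 / (1 - \<xi> $ a * cnj (\<xi> $ j))\<^sup>2 else 0) * cnj v"
    have "((\<lambda>t. x t $ a / (1 - x t $ a * cnj (x t $ j))) has_vector_derivative ?d a) (at 0)" for a
    proof -
      let ?u = "1 - \<xi> $ a * cnj (\<xi> $ j)"
      let ?u' = "- (\<xi> $ a * (if j = i then cnj v else 0) + (if a = i then v else 0) * cnj (\<xi> $ j))"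
      have u: "?u \<noteq> 0" using neq1[of a j] by simp
      have "(inverse has_field_derivative - (inverse ?u)\<^sup>2) (at (1 - (\<xi> + 0 *\<^sub>R axis i v) $ a * cnj ((\<xi> + 0 *\<^sub>R axis i v) $ j)))"
        using DERIV_inverse[of ?u UNIV] u by (simp add: numeral_2_eq_2)
      from field_vector_diff_chain_at[OF has_vector_derivative_factor[of \<xi> i v a j] this]
      have "((\<lambda>t. inverse (1 - x t $ a * cnj (x t $ j))) has_vector_derivative
          ?u' * - (inverse ?u)\<^sup>2) (at 0)"
        by (simp add: o_def x_def)
      from has_vector_derivative_mult[OF has_vector_derivative_coord[of \<xi> i v a, folded x_def] this]
      have "((\<lambda>t. x t $ a * inverse (1 - x t $ a * cnj (x t $ j))) has_vector_derivative
          \<xi> $ a * (?u' * - (inverse ?u)\<^sup>2) + (if a = i then v else 0) * inverse ?u) (at 0)"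
        by (simp add: x_def)
      moreover have "\<xi> $ a * (?u' * - (inverse ?u)\<^sup>2) + (if a = i then v else 0) * inverse ?u = ?d a"
      proof -
        \<comment> \<open>The derivative of p / (1 - p q); the \<open>p'\<close> terms merge because
          p q + (1 - p q) = 1.\<close>
        have alg: "p * (- (p * q' + p' * q) * - (inverse (1 - p * q))\<^sup>2) + p' * inverse (1 - p * q)
            = p' / (1 - p * q)\<^sup>2 + p\<^sup>2 / (1 - p * q)\<^sup>2 * q'"
          if "1 - p * q \<noteq> 0" for p q p' q' :: complex
          using that by (simp add: divide_simps) (simp add: algebra_simps power2_eq_square)
        show ?thesis
          using alg[OF u] by simp
      qed
      ultimately show ?thesis by (simp add: divide_inverse)
    qed
    then have "((\<lambda>t. phi_dlog_bar j (x t)) has_vector_derivative - (\<Sum>a\<in>UNIV. ?d a)) (at 0)"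
      unfolding phi_dlog_bar_def by (intro has_vector_derivative_minus has_vector_derivative_sum)
    moreover have "- (\<Sum>a\<in>UNIV. ?d a) = - v / (1 - \<xi> $ i * cnj (\<xi> $ j))\<^sup>2 - S * cnj v"
    proof -
      have "(\<Sum>a\<in>UNIV. (if a = i then v else 0) / (1 - \<xi> $ a * cnj (\<xi> $ j))\<^sup>2)
          = v / (1 - \<xi> $ i * cnj (\<xi> $ j))\<^sup>2"
        by (subst sum.remove[of _ i]) auto
      then show ?thesis
        by (simp add: S_def sum.distrib sum_distrib_right)
    qed
    ultimately show ?thesis by simp
  qed
  have "((\<lambda>t. ar_phi (x t) * phi_dlog_bar j (x t)) has_vector_derivative
      ar_phi (x 0) * (- v / (1 - \<xi> $ i * cnj (\<xi> $ j))\<^sup>2 - S * cnj v)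
      + ar_phi \<xi> * (phi_dlog i \<xi> * v + phi_dlog_bar i \<xi> * cnj v) * phi_dlog_bar j (x 0)) (at 0)"
    by (intro has_vector_derivative_mult dlog has_vector_derivative_ar_phi[OF neq1, folded x_def])
      (simp add: x_def has_vector_derivative_ar_phi[OF neq1])
  then have "((\<lambda>t. wirtinger_bar j ar_phi (x t)) has_vector_derivative
      ar_phi (x 0) * (- v / (1 - \<xi> $ i * cnj (\<xi> $ j))\<^sup>2 - S * cnj v)
      + ar_phi \<xi> * (phi_dlog i \<xi> * v + phi_dlog_bar i \<xi> * cnj v) * phi_dlog_bar j (x 0)) (at 0)"
  proof (rule has_vector_derivative_transform_at)
    \<comment> \<open>The outer derivative needs the formula \<open>bar\<close> on a neighbourhood;
      by continuity no factor of phi vanishes for small \<open>t\<close>.\<close>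
    have "\<forall>\<^sub>F t in at 0. \<forall>a b. x t $ a * cnj (x t $ b) \<noteq> 1"
    proof (intro eventually_all_finite)
      fix a b
      have "((\<lambda>t. x t $ a * cnj (x t $ b)) \<longlongrightarrow> x 0 $ a * cnj (x 0 $ b)) (at 0)"
        unfolding x_def by (intro tendsto_intros)
      then show "\<forall>\<^sub>F t in at 0. x t $ a * cnj (x t $ b) \<noteq> 1"
        using neq1 by (intro tendsto_imp_eventually_ne) (auto simp: x0)
    qed
    then show "\<forall>\<^sub>F t in at 0. ar_phi (x t) * phi_dlog_bar j (x t) = wirtinger_bar j ar_phi (x t)"
      by eventually_elim (simp add: bar)
    show "ar_phi (x 0) * phi_dlog_bar j (x 0) = wirtinger_bar j ar_phi (x 0)"
      using neq1 by (simp add: bar x0)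
  qed
  then show "((\<lambda>t. wirtinger_bar j ar_phi (\<xi> + t *\<^sub>R axis i v)) has_vector_derivative
      ar_phi \<xi> * (phi_dlog i \<xi> * phi_dlog_bar j \<xi> - 1 / (1 - \<xi> $ i * cnj (\<xi> $ j))\<^sup>2) * v
      + ar_phi \<xi> * (phi_dlog_bar i \<xi> * phi_dlog_bar j \<xi> - S) * cnj v) (at 0)"
    by (simp add: x_def algebra_simps)
qed

section \<open>The inverse metric on \<open>Theta1\<close> and the eigenvalue equation\<close>

lemma Theta1_cauchy_nodes:
  fixes \<xi> :: "complex ^ 'p::finite"
  assumes "\<xi> \<in> Theta1"
  shows "cauchy_nodes (\<lambda>i. \<xi> $ i) (\<lambda>j. cnj (\<xi> $ j))"
proof
  show "inj (\<lambda>i. \<xi> $ i)" "inj (\<lambda>j. cnj (\<xi> $ j))"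
    using assms by (auto simp: Theta1_def inj_def)
  fix i j
  have "cmod (\<xi> $ i) * cmod (cnj (\<xi> $ j)) < 1 * 1"
    using assms by (intro mult_strict_mono') (auto simp: Theta1_def)
  then show "\<xi> $ i * cnj (\<xi> $ j) \<noteq> 1"
    by (metis norm_mult norm_one mult_1 less_irrefl)
qed

text \<open>\<open>matrix_inv\<close> is a choice, so invertibility comes first, from the trivial
  kernel. The two sided inverse laws then give duality along rows and along columns.\<close>

lemma inverse_ar_metric:
  fixes \<xi> :: "complex ^ 'p::finite"
  assumes "\<xi> \<in> Theta1"
  defines "h \<equiv> inverse_metric ar_metric \<xi>"
  shows "(\<Sum>j\<in>UNIV. h $ i $ j / (1 - \<xi> $ k * cnj (\<xi> $ j))) = (if k = i then 1 else 0)"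
    and "(\<Sum>i\<in>UNIV. h $ i $ j / (1 - \<xi> $ i * cnj (\<xi> $ k))) = (if k = j then 1 else 0)"
proof -
  interpret cauchy_nodes "\<lambda>i. \<xi> $ i" "\<lambda>j. cnj (\<xi> $ j)"
    using assms by (intro Theta1_cauchy_nodes)
  let ?G = "ar_metric \<xi>"
  have "c = 0" if "?G *v c = 0" for c
  proof -
    have "(\<Sum>j\<in>UNIV. c $ j / (1 - \<xi> $ k * cnj (\<xi> $ j))) = 0" for k
      using arg_cong[OF that, of "\<lambda>u. u $ k"]
      by (simp add: matrix_vector_mult_def ar_metric_def)
    then show ?thesis
      using cauchy_kernel_trivial[of "\<lambda>j. c $ j"] by (simp add: vec_eq_iff)
  qed
  then have "invertible ?G"
    by (simp add: invertible_left_inverse matrix_left_invertible_ker)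
  then have "invertible (transpose ?G)"
    by (metis invertible_left_inverse invertible_right_inverse right_invertible_transpose)
  then have inv: "h ** transpose ?G = mat 1" "transpose ?G ** h = mat 1"
    unfolding h_def inverse_metric_def matrix_inv_def invertible_def
    using someI_ex[where P = "\<lambda>A'. transpose ?G ** A' = mat 1 \<and> A' ** transpose ?G = mat 1"]
    by blast+
  show "(\<Sum>j\<in>UNIV. h $ i $ j / (1 - \<xi> $ k * cnj (\<xi> $ j))) = (if k = i then 1 else 0)"
    using arg_cong[OF inv(1), of "\<lambda>A. A $ i $ k"]
    by (auto simp: matrix_matrix_mult_def transpose_def ar_metric_def mat_def)
  show "(\<Sum>i\<in>UNIV. h $ i $ j / (1 - \<xi> $ i * cnj (\<xi> $ k))) = (if k = j then 1 else 0)"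
    using arg_cong[OF inv(2), of "\<lambda>A. A $ k $ j"]
    by (auto simp: matrix_matrix_mult_def transpose_def ar_metric_def mat_def)
qed

theorem propositionV1:
  fixes \<xi> :: "complex ^ 'p::finite"
  assumes "\<xi> \<in> Theta1"
  shows "kaehler_laplacian ar_metric ar_phi \<xi> = - (of_nat CARD('p) * (of_nat CARD('p) + 1)) * ar_phi \<xi>"
proof -
  interpret cauchy_nodes "\<lambda>i. \<xi> $ i" "\<lambda>j. cnj (\<xi> $ j)"
    using assms by (rule Theta1_cauchy_nodes)
  let ?h = "inverse_metric ar_metric \<xi>"
  have "kaehler_laplacian ar_metric ar_phi \<xi> = 2 * (\<Sum>i\<in>UNIV. \<Sum>j\<in>UNIV. ?h $ i $ j *
      (phi_dlog i \<xi> * phi_dlog_bar j \<xi> - 1 / (1 - \<xi> $ i * cnj (\<xi> $ j))\<^sup>2)) * ar_phi \<xi>"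
    unfolding kaehler_laplacian_def wirtinger_wirtinger_bar_ar_phi[OF neq1] sum_distrib_right
      mult.assoc
    by (intro arg_cong[where f = "\<lambda>s. 2 * s"] sum.cong refl) (simp only: mult_ac)
  \<comment> \<open>The minus signs of \<open>phi_dlog\<close> and \<open>phi_dlog_bar\<close>
    cancel in their product, which gives the shape of \<open>cauchy_contraction\<close>.\<close>
  then show ?thesis
    using cauchy_contraction[OF inverse_ar_metric[OF assms]]
    by (simp add: phi_dlog_def phi_dlog_bar_def)
qed

end
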